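(* Let $n\ge 3$, $k\ge 1$, and let $P_1,\dots,P_k$ be (centered) cyclic regular hyperbolic $n$-gons with given total circumradius $\sum_{i=1}^k R(P_i)=T$. Then $$\sum_{i=1}^k \mathrm{Peri}(P_i)\;\geq\; 2nk\,\sinh^{-1}\!\left(\sin(\pi/n)\,\sinh(T/k)\right),$$ with equality if and only if all $P_i$ are isometric to a regular $n$-gon of circumradius $T/k$.
   Context: A hyperbolic $n$-gon is a polygon with $n$ geodesic sides in the hyperbolic plane of constant curvature $-1$; all of its vertices are assumed to lie in the hyperbolic plane (no ideal vertices). A polygon is cyclic if all its vertices lie on the same circle (its circumcircle); $R(P)$ denotes the (hyperbolic) radius of the circumcircle. A cyclic polygon $P$ is centered if the center of its circumcircle lies in the interior of $P$. $\mathrm{Peri}(P)$ is the sum of the hyperbolic lengths of the sides. A polygon is regular if all its sides are equal and all its interior angles are equal. *)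

theory Defs
  imports "HOL-Analysis.Analysis"
begin

text \<open>The hyperbolic plane is the Poincare disc with the metric \<open>2 |dz| / (1 - |z|\<^sup>2)\<close>,
  which has curvature \<open>-1\<close>.\<close>

definition hyp_plane :: "complex set" where
  "hyp_plane = ball 0 1"

definition hyp_dist :: "complex \<Rightarrow> complex \<Rightarrow> real" where
  "hyp_dist z w =
     arcosh (1 + 2 * (cmod (z - w))\<^sup>2 / ((1 - (cmod z)\<^sup>2) * (1 - (cmod w)\<^sup>2)))"

definition hyp_segment :: "complex \<Rightarrow> complex \<Rightarrow> complex set" where
  "hyp_segment a b = {x \<in> hyp_plane. hyp_dist a x + hyp_dist x b = hyp_dist a b}"

definition hyp_circle :: "complex \<Rightarrow> real \<Rightarrow> complex set" where
  "hyp_circle c R = {z \<in> hyp_plane. hyp_dist c z = R}"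

definition hyp_isometry :: "(complex \<Rightarrow> complex) \<Rightarrow> bool" where
  "hyp_isometry f \<longleftrightarrow> bij_betw f hyp_plane hyp_plane \<and>
     (\<forall>z\<in>hyp_plane. \<forall>w\<in>hyp_plane. hyp_dist (f z) (f w) = hyp_dist z w)"

text \<open>A polygon is given by the list of its vertices, in the order in which they occur along
  the boundary. Its boundary is required to be a simple closed curve: two different sides meet
  exactly in their common endpoints.\<close>

definition next_vertex :: "complex list \<Rightarrow> nat \<Rightarrow> complex" where
  "next_vertex P i = P ! (Suc i mod length P)"

definition hyp_side :: "complex list \<Rightarrow> nat \<Rightarrow> complex set" where
  "hyp_side P i = hyp_segment (P ! i) (next_vertex P i)"

definition hyp_sides :: "complex list \<Rightarrow> complex set set" where
  "hyp_sides P = hyp_side P ` {..<length P}"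

definition side_length :: "complex list \<Rightarrow> nat \<Rightarrow> real" where
  "side_length P i = hyp_dist (P ! i) (next_vertex P i)"

definition hyp_polygon :: "nat \<Rightarrow> complex list \<Rightarrow> bool" where
  "hyp_polygon n P \<longleftrightarrow> n \<ge> 3 \<and> length P = n \<and> distinct P \<and> set P \<subseteq> hyp_plane \<and>
     (\<forall>i<n. \<forall>j<n. i \<noteq> j \<longrightarrow>
        hyp_side P i \<inter> hyp_side P j = {P ! i, next_vertex P i} \<inter> {P ! j, next_vertex P j})"

text \<open>The boundary is compact in the disc, so the component of its complement that is bounded
  in \<open>\<complex>\<close> is also the one that is relatively compact in the hyperbolic plane.\<close>

definition hyp_interior :: "complex list \<Rightarrow> complex set" where
  "hyp_interior P = inside (\<Union> (hyp_sides P))"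

definition perimeter :: "complex list \<Rightarrow> real" where
  "perimeter P = (\<Sum>i<length P. side_length P i)"

definition circumcircle :: "complex list \<Rightarrow> complex \<Rightarrow> real \<Rightarrow> bool" where
  "circumcircle P c R \<longleftrightarrow> c \<in> hyp_plane \<and> R > 0 \<and> set P \<subseteq> hyp_circle c R"

definition cyclic_polygon :: "complex list \<Rightarrow> bool" where
  "cyclic_polygon P \<longleftrightarrow> (\<exists>c R. circumcircle P c R)"

text \<open>Three distinct points lie on at most one circle, so for a cyclic polygon the radius below
  is well defined.\<close>

definition circumradius :: "complex list \<Rightarrow> real" where
  "circumradius P = (THE R. \<exists>c. circumcircle P c R)"

definition centered_polygon :: "complex list \<Rightarrow> bool" where
  "centered_polygon P \<longleftrightarrow> (\<exists>c R. circumcircle P c R \<and> c \<in> hyp_interior P)"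

text \<open>The point at distance \<open>t\<close> from \<open>v\<close> on the geodesic ray that leaves \<open>v\<close> in the direction
  \<open>cis \<theta>\<close>. The point \<open>tanh (t/2) * cis \<theta>\<close> is at distance \<open>t\<close> from \<open>0\<close>, and the isometry
  \<open>w \<mapsto> (w + v) / (1 + cnj v * w)\<close> takes \<open>0\<close> to \<open>v\<close> with derivative \<open>1 - |v|\<^sup>2 > 0\<close> there,
  so it preserves directions.\<close>

definition hyp_ray :: "complex \<Rightarrow> real \<Rightarrow> real \<Rightarrow> complex" where
  "hyp_ray v \<theta> t =
     (let w = of_real (tanh (t / 2)) * cis \<theta> in (w + v) / (1 + cnj v * w))"

text \<open>The interior angle is the total angular size of the set of directions that point from the
  vertex into the interior; it can exceed \<open>\<pi>\<close>. Angles are Euclidean because the model is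
  conformal.\<close>

definition interior_angle :: "complex list \<Rightarrow> complex \<Rightarrow> real" where
  "interior_angle P v = measure lborel
     {\<theta> \<in> {0..<2 * pi}. \<forall>\<^sub>F t in at_right 0. hyp_ray v \<theta> t \<in> hyp_interior P}"

definition regular_polygon :: "complex list \<Rightarrow> bool" where
  "regular_polygon P \<longleftrightarrow>
     (\<forall>i<length P. \<forall>j<length P. side_length P i = side_length P j) \<and>
     (\<forall>u\<in>set P. \<forall>v\<in>set P. interior_angle P u = interior_angle P v)"

text \<open>Congruence by a (possibly orientation-reversing) isometry of the plane that takes sides to
  sides; it then takes vertices to vertices and interior to interior. The labelling of the
  vertices plays no role.\<close>

definition isometric_polygons :: "complex list \<Rightarrow> complex list \<Rightarrow> bool" where
  "isometric_polygons P Q \<longleftrightarrow>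
     (\<exists>f. hyp_isometry f \<and> (\<lambda>s. f ` s) ` hyp_sides P = hyp_sides Q)"

end

theory Submission
  imports Defs "HOL-Complex_Analysis.Riemann_Mapping"
begin

text \<open>An isometry moves the circumcentre of a cyclic equilateral polygon to the origin. Equal sides
  then force consecutive vertices to differ by a fixed rotation, so the polygon is a regular star
  polygon \<open>{n/m}\<close>, and simplicity of the boundary leaves only \<open>m = 1\<close> up to reflection. Hence
  the polygon is determined up to isometry by its circumradius \<open>R\<close>, and its perimeter is
  \<open>2 n arsinh (sin (pi/n) sinh R)\<close>. This is a strictly convex function of \<open>R\<close>, and Jensen's
  inequality gives the bound with its equality case. Conversely, an isometry that takes sides to
  sides preserves the circumradius, because the vertices are the common points of different
  sides.\<close>

section \<open>Isometries and geodesics of the Poincare disc\<close>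

text \<open>The argument of \<open>arcosh\<close> in \<open>hyp_dist\<close>. It is rational in the
  coordinates, so distances are compared and transformed through it.\<close>

definition hyp_cosh :: "complex \<Rightarrow> complex \<Rightarrow> real" where
  "hyp_cosh z w = 1 + 2 * (cmod (z - w))\<^sup>2 / ((1 - (cmod z)\<^sup>2) * (1 - (cmod w)\<^sup>2))"

lemma hyp_plane_iff: "z \<in> hyp_plane \<longleftrightarrow> cmod z < 1"
  by (simp add: hyp_plane_def)

lemma hyp_plane_norm_sq: "z \<in> hyp_plane \<Longrightarrow> 0 < 1 - (cmod z)\<^sup>2"
  by (simp add: hyp_plane_iff power_less_one_iff)

lemma hyp_dist_altdef: "hyp_dist z w = arcosh (hyp_cosh z w)"
  by (simp add: hyp_dist_def hyp_cosh_def)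

lemma hyp_cosh_ge_1: "z \<in> hyp_plane \<Longrightarrow> w \<in> hyp_plane \<Longrightarrow> 1 \<le> hyp_cosh z w"
  using hyp_plane_norm_sq[of z] hyp_plane_norm_sq[of w] by (simp add: hyp_cosh_def)

lemma cosh_hyp_dist: "z \<in> hyp_plane \<Longrightarrow> w \<in> hyp_plane \<Longrightarrow> cosh (hyp_dist z w) = hyp_cosh z w"
  by (simp add: hyp_dist_altdef hyp_cosh_ge_1)

lemma hyp_dist_nonneg: "z \<in> hyp_plane \<Longrightarrow> w \<in> hyp_plane \<Longrightarrow> 0 \<le> hyp_dist z w"
  by (simp add: hyp_dist_altdef hyp_cosh_ge_1)

lemma hyp_cosh_commute: "hyp_cosh z w = hyp_cosh w z"
  by (simp add: hyp_cosh_def norm_minus_commute mult.commute)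

lemma hyp_dist_eq_iff:
  assumes "z \<in> hyp_plane" "w \<in> hyp_plane" "z' \<in> hyp_plane" "w' \<in> hyp_plane"
  shows "hyp_dist z w = hyp_dist z' w' \<longleftrightarrow> hyp_cosh z w = hyp_cosh z' w'"
  by (metis assms cosh_hyp_dist hyp_dist_altdef)

lemma hyp_isometry_image_segment:
  assumes f: "hyp_isometry f" and ab: "a \<in> hyp_plane" "b \<in> hyp_plane"
  shows "f ` hyp_segment a b = hyp_segment (f a) (f b)"
proof -
  have "f ` {x \<in> hyp_plane. hyp_dist a x + hyp_dist x b = hyp_dist a b}
      = {y \<in> f ` hyp_plane. hyp_dist (f a) y + hyp_dist y (f b) = hyp_dist (f a) (f b)}"
    using f ab by (auto simp: hyp_isometry_def)
  then show ?thesis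
    using f by (simp add: hyp_segment_def hyp_isometry_def bij_betw_def)
qed

lemma hyp_isometry_comp:
  "hyp_isometry f \<Longrightarrow> hyp_isometry g \<Longrightarrow> hyp_isometry (g \<circ> f)"
  unfolding hyp_isometry_def by (auto intro: bij_betw_trans dest: bij_betwE)

lemma hyp_isometry_inv:
  assumes "hyp_isometry f"
  shows "hyp_isometry (inv_into hyp_plane f)"
proof -
  have f: "bij_betw f hyp_plane hyp_plane" using assms by (simp add: hyp_isometry_def)
  have "hyp_dist (inv_into hyp_plane f z) (inv_into hyp_plane f w) = hyp_dist z w"
    if "z \<in> hyp_plane" "w \<in> hyp_plane" for z w
  proof -
    from f that have "inv_into hyp_plane f z \<in> hyp_plane" "inv_into hyp_plane f w \<in> hyp_plane"
      by (meson bij_betwE bij_betw_inv_into)+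
    with assms have "hyp_dist (f (inv_into hyp_plane f z)) (f (inv_into hyp_plane f w))
        = hyp_dist (inv_into hyp_plane f z) (inv_into hyp_plane f w)"
      by (simp add: hyp_isometry_def)
    with f that show ?thesis by (simp add: bij_betw_inv_into_right)
  qed
  with f show ?thesis by (simp add: hyp_isometry_def bij_betw_inv_into)
qed

lemma hyp_isometry_cnj: "hyp_isometry cnj"
proof -
  have "bij_betw cnj hyp_plane hyp_plane"
    by (rule bij_betwI[where g = cnj]) (auto simp: hyp_plane_iff)
  moreover have "hyp_dist (cnj z) (cnj w) = hyp_dist z w" for z w
    by (simp add: hyp_dist_def flip: complex_cnj_diff)
  ultimately show ?thesis by (simp add: hyp_isometry_def)
qed

lemma hyp_isometry_rotation:
  assumes "cmod u = 1"
  shows "hyp_isometry (\<lambda>z. u * z)"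
proof -
  have "bij_betw (\<lambda>z. u * z) hyp_plane hyp_plane"
    by (rule bij_betwI[where g = "\<lambda>z. z / u"]) (use assms in \<open>auto simp: hyp_plane_iff norm_mult norm_divide\<close>)
  moreover have "hyp_dist (u * z) (u * w) = hyp_dist z w" for z w
    using assms by (simp add: hyp_dist_def norm_mult flip: right_diff_distrib)
  ultimately show ?thesis by (simp add: hyp_isometry_def)
qed

lemma Moebius_denominator_nonzero:
  assumes "c \<in> hyp_plane" "z \<in> hyp_plane"
  shows "1 - cnj c * z \<noteq> 0"
proof
  assume "1 - cnj c * z = 0"
  then have "cmod (cnj c * z) = 1" by simp
  moreover have "cmod (cnj c * z) < 1"
    using assms norm_mult_less[of "cnj c" 1 z 1] by (simp add: hyp_plane_iff)
  ultimately show False by simp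
qed

text \<open>Divide the identity |1 - \<open>cnj c * z\<close>|^2 - |z - c|^2 = (1 - |c|^2) (1 -
  |z|^2) by its first term.\<close>

lemma one_minus_norm_Moebius:
  assumes "c \<in> hyp_plane" "z \<in> hyp_plane"
  shows "1 - (cmod (Moebius_function 0 c z))\<^sup>2
       = (1 - (cmod c)\<^sup>2) * (1 - (cmod z)\<^sup>2) / (cmod (1 - cnj c * z))\<^sup>2"
proof -
  have "(cmod (1 - cnj c * z))\<^sup>2 - (cmod (z - c))\<^sup>2 = (1 - (cmod c)\<^sup>2) * (1 - (cmod z)\<^sup>2)"
    unfolding cmod_power2 by (simp add: algebra_simps power2_eq_square)
  then show ?thesis
    using Moebius_denominator_nonzero[OF assms]
    by (simp add: Moebius_function_simple norm_divide power_divide field_simps)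
qed

lemma hyp_isometry_Moebius:
  assumes c: "c \<in> hyp_plane"
  shows "hyp_isometry (Moebius_function 0 c)"
proof -
  have "bij_betw (Moebius_function 0 c) hyp_plane hyp_plane"
    using c Moebius_function_norm_lt_1
    by (intro bij_betwI[where g = "Moebius_function 0 (- c)"])
      (auto simp: hyp_plane_iff Moebius_function_compose)
  moreover have "hyp_dist (Moebius_function 0 c z) (Moebius_function 0 c w) = hyp_dist z w"
    if z: "z \<in> hyp_plane" and w: "w \<in> hyp_plane" for z w
  proof -
    note dz = Moebius_denominator_nonzero[OF c z] and dw = Moebius_denominator_nonzero[OF c w]
    have "Moebius_function 0 c z - Moebius_function 0 c w
        = (1 - cnj c * c) * (z - w) / ((1 - cnj c * z) * (1 - cnj c * w))"
      using dz dw by (simp add: Moebius_function_simple field_simps)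
    moreover have "cmod (1 - cnj c * c) = 1 - (cmod c)\<^sup>2"
    proof -
      have "1 - cnj c * c = of_real (1 - (cmod c)\<^sup>2)"
        by (simp add: mult.commute flip: complex_norm_square)
      then show ?thesis using hyp_plane_norm_sq[OF c] by (metis norm_of_real abs_of_pos)
    qed
    ultimately have *: "cmod (Moebius_function 0 c z - Moebius_function 0 c w)
        = (1 - (cmod c)\<^sup>2) * cmod (z - w) / (cmod (1 - cnj c * z) * cmod (1 - cnj c * w))"
      by (simp add: norm_mult norm_divide)
    \<comment> \<open>\<open>K\<close> stands for 1 - |c|^2, and \<open>p\<close>, \<open>q\<close>
      for the moduli of the two denominators. They enter the squared chord and the product of the
      conformal factors in the same way and drop out.\<close>
    have cancel: "2 * (K * D / (p * q))\<^sup>2 / ((K * X / p\<^sup>2) * (K * Y / q\<^sup>2)) = 2 * D\<^sup>2 / (X * Y)"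
      if "K \<noteq> 0" "p \<noteq> 0" "q \<noteq> 0" for K D X Y p q :: real
      using that by (simp add: power2_eq_square)
    show ?thesis
      unfolding hyp_dist_def one_minus_norm_Moebius[OF c z]
        one_minus_norm_Moebius[OF c w] *
      using dz dw hyp_plane_norm_sq[OF c] by (subst cancel) auto
  qed
  ultimately show ?thesis by (simp add: hyp_isometry_def)
qed

section \<open>Segments in the hyperboloid model\<close>

lemma zero_in_hyp_plane: "0 \<in> hyp_plane"
  by (simp add: hyp_plane_iff)

text \<open>A point of the hyperboloid model has time coordinate \<open>hyp_time z\<close> and space
  coordinate \<open>hyp_space z\<close>; there geodesics are sections by planes through the origin.\<close>

definition hyp_time :: "complex \<Rightarrow> real" where
  "hyp_time z = (1 + (cmod z)\<^sup>2) / (1 - (cmod z)\<^sup>2)"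

definition hyp_space :: "complex \<Rightarrow> complex" where
  "hyp_space z = (2 / (1 - (cmod z)\<^sup>2)) *\<^sub>R z"

text \<open>The right-hand side is the Minkowski product of two points of the hyperboloid. Its
  bilinearity turns questions about distances into linear algebra.\<close>

lemma hyp_cosh_hyperboloid:
  assumes "z \<in> hyp_plane" "w \<in> hyp_plane"
  shows "hyp_cosh z w = hyp_time z * hyp_time w - hyp_space z \<bullet> hyp_space w"
proof -
  have "(cmod (z - w))\<^sup>2 = (cmod z)\<^sup>2 + (cmod w)\<^sup>2 - 2 * (z \<bullet> w)"
    by (simp add: dot_norm_neg field_simps)
  moreover have "1 + 2 * (p + q - 2 * r) / ((1 - p) * (1 - q))
      = (1 + p) / (1 - p) * ((1 + q) / (1 - q)) - 2 / (1 - p) * (2 / (1 - q)) * r"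
    if "0 < 1 - p" "0 < 1 - q" for p q r :: real
  proof -
    from that have "1 = (1 - p) * (1 - q) / ((1 - p) * (1 - q))" by simp
    then have "1 + 2 * (p + q - 2 * r) / ((1 - p) * (1 - q))
        = ((1 - p) * (1 - q) + 2 * (p + q - 2 * r)) / ((1 - p) * (1 - q))"
      by (metis add_divide_distrib)
    also have "\<dots> = ((1 + p) * (1 + q) - 4 * r) / ((1 - p) * (1 - q))"
      by (simp add: algebra_simps)
    finally show ?thesis by (simp add: diff_divide_distrib)
  qed
  ultimately show ?thesis
    using hyp_plane_norm_sq[OF assms(1)] hyp_plane_norm_sq[OF assms(2)]
    by (simp add: hyp_cosh_def hyp_time_def hyp_space_def mult.assoc)
qed

lemma hyp_cosh_self: "hyp_cosh z z = 1"
  by (simp add: hyp_cosh_def)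

text \<open>The \<open>sinh\<close> of the distances from \<open>x\<close> to \<open>a\<close> and
  \<open>b\<close> turns out to be \<open>m * S\<close> and \<open>l * S\<close>, and the addition
  theorem for \<open>cosh\<close> then gives the total distance. Nonnegative weights fix the signs
  and place \<open>x\<close> between \<open>a\<close> and \<open>b\<close>.\<close>

lemma in_hyp_segment_hyperboloid:
  assumes a: "a \<in> hyp_plane" and b: "b \<in> hyp_plane" and x: "x \<in> hyp_plane"
    and "0 \<le> l" "0 \<le> m"
    and t: "hyp_time x = l * hyp_time a + m * hyp_time b"
    and s: "hyp_space x = l *\<^sub>R hyp_space a + m *\<^sub>R hyp_space b"
  shows "x \<in> hyp_segment a b"
proof -
  define C where "C = hyp_cosh a b"
  define S where "S = sinh (hyp_dist a b)"
  have "0 \<le> S" using hyp_dist_nonneg[OF a b] by (simp add: S_def)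
  have S2: "S\<^sup>2 = C\<^sup>2 - 1"
    using cosh_square_eq[of "hyp_dist a b"] by (simp add: S_def C_def cosh_hyp_dist a b)
  have comb: "hyp_cosh y x = l * hyp_cosh y a + m * hyp_cosh y b" if "y \<in> hyp_plane" for y
    using that a b x by (simp add: hyp_cosh_hyperboloid t s inner_right_distrib algebra_simps)
  have ax: "hyp_cosh a x = l + m * C"
    using comb[OF a] by (simp add: hyp_cosh_self C_def)
  have bx: "hyp_cosh b x = l * C + m"
    using comb[OF b] by (simp add: hyp_cosh_self C_def hyp_cosh_commute)
  have "hyp_cosh x x = l * hyp_cosh a x + m * hyp_cosh b x"
    using comb[OF x] by (simp add: hyp_cosh_commute)
  \<comment> \<open>The combination has Minkowski norm 1 because \<open>x\<close> itself lies on the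
    hyperboloid.\<close>
  then have unit: "1 = l\<^sup>2 + m\<^sup>2 + 2 * l * m * C"
    by (simp add: hyp_cosh_self ax bx algebra_simps power2_eq_square)
  have sinh_eq: "sinh (hyp_dist y x) = k * S"
    if "y \<in> hyp_plane" "0 \<le> k" "(hyp_cosh y x)\<^sup>2 - 1 = (k * S)\<^sup>2" for y k
  proof -
    have "(sinh (hyp_dist y x))\<^sup>2 = (k * S)\<^sup>2"
      using cosh_square_eq[of "hyp_dist y x"] that x by (simp add: cosh_hyp_dist)
    then show ?thesis
      using hyp_dist_nonneg[OF that(1) x] that(2) \<open>0 \<le> S\<close> by (simp add: power2_eq_iff_nonneg)
  qed
  have "sinh (hyp_dist a x) = m * S"
    using a \<open>0 \<le> m\<close>
  proof (rule sinh_eq)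
    show "(hyp_cosh a x)\<^sup>2 - 1 = (m * S)\<^sup>2"
      unfolding ax power_mult_distrib S2 using unit by (simp add: power2_eq_square algebra_simps)
  qed
  moreover have "sinh (hyp_dist b x) = l * S"
    using b \<open>0 \<le> l\<close>
  proof (rule sinh_eq)
    show "(hyp_cosh b x)\<^sup>2 - 1 = (l * S)\<^sup>2"
      unfolding bx power_mult_distrib S2 using unit by (simp add: power2_eq_square algebra_simps)
  qed
  ultimately have "cosh (hyp_dist a x + hyp_dist b x) = (l + m * C) * (l * C + m) + m * l * S\<^sup>2"
    by (simp add: cosh_add cosh_hyp_dist a b x ax bx power2_eq_square)
  also have "\<dots> = C * (l\<^sup>2 + m\<^sup>2 + 2 * l * m * C)"
    unfolding S2 by (simp add: power2_eq_square algebra_simps)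
  also have "\<dots> = cosh (hyp_dist a b)"
    using unit a b by (simp add: C_def cosh_hyp_dist)
  finally have "hyp_dist a x + hyp_dist b x = hyp_dist a b"
    using hyp_dist_nonneg a b x by (metis add_nonneg_nonneg arcosh_cosh_real)
  then show ?thesis
    using x by (simp add: hyp_segment_def hyp_dist_altdef hyp_cosh_commute)
qed

text \<open>Stereographic projection from \<open>(-1, 0)\<close> maps the upper sheet of the
  hyperboloid onto the disc and supplies the witness y / (1 + t).\<close>

lemma hyperboloid_point_exists:
  assumes "0 < t" and "t\<^sup>2 - (cmod y)\<^sup>2 = 1"
  obtains x where "x \<in> hyp_plane" "hyp_time x = t" "hyp_space x = y"
proof
  define x where "x = (1 / (1 + t)) *\<^sub>R y"
  have nx: "(cmod x)\<^sup>2 = (t\<^sup>2 - 1) / (1 + t)\<^sup>2"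
    using assms by (simp add: x_def power_divide)
  then have nx': "(cmod x)\<^sup>2 = (t - 1) / (t + 1)"
  proof -
    have "(cmod x)\<^sup>2 = ((t - 1) * (t + 1)) / ((t + 1) * (t + 1))"
      unfolding nx by (simp add: power2_eq_square algebra_simps)
    then show ?thesis using assms(1) by simp
  qed
  have d: "1 - (cmod x)\<^sup>2 = 2 / (t + 1)" and e: "1 + (cmod x)\<^sup>2 = 2 * t / (t + 1)"
    unfolding nx' using assms(1) by (simp_all add: field_simps)
  have "0 < 1 - (cmod x)\<^sup>2" using assms(1) d by simp
  then show "x \<in> hyp_plane" by (simp add: hyp_plane_iff power_less_one_iff)
  show "hyp_time x = t" "hyp_space x = y"
    using assms(1) unfolding hyp_time_def hyp_space_def d e by (simp_all add: x_def add.commute)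
qed

section \<open>Circumscribed circles\<close>

text \<open>For positive \<open>R\<close>, \<open>tanh (R / 2)\<close> is the Euclidean radius of
  the circle of hyperbolic radius \<open>R\<close> about the origin. The first two formulas thus
  give \<open>hyp_time\<close> and the norm of \<open>hyp_space\<close> on that circle.\<close>

lemma cosh_sinh_half_tanh:
  fixes R :: real
  shows "cosh R = (1 + (tanh (R / 2))\<^sup>2) / (1 - (tanh (R / 2))\<^sup>2)"
    and "sinh R = 2 * tanh (R / 2) / (1 - (tanh (R / 2))\<^sup>2)"
    and "0 < 1 - (tanh (R / 2))\<^sup>2"
proof -
  define c s where "c = cosh (R / 2)" and "s = sinh (R / 2)"
  have "c > 0" by (simp add: c_def)
  have cs: "c\<^sup>2 = s\<^sup>2 + 1" by (simp add: c_def s_def cosh_square_eq)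
  have t: "tanh (R / 2) = s / c" by (simp add: tanh_def c_def s_def)
  have d: "1 - (s / c)\<^sup>2 = 1 / c\<^sup>2"
  proof -
    have "1 - (s / c)\<^sup>2 = (c\<^sup>2 - s\<^sup>2) / c\<^sup>2"
      using \<open>c > 0\<close> by (simp add: power_divide diff_divide_distrib)
    then show ?thesis using cs by simp
  qed
  show "0 < 1 - (tanh (R / 2))\<^sup>2" unfolding t d using \<open>c > 0\<close> by simp
  have "cosh R = c\<^sup>2 + s\<^sup>2" "sinh R = 2 * s * c"
    using cosh_double[of "R / 2"] sinh_double[of "R / 2"] by (simp_all add: c_def s_def)
  then show "cosh R = (1 + (tanh (R / 2))\<^sup>2) / (1 - (tanh (R / 2))\<^sup>2)"
    "sinh R = 2 * tanh (R / 2) / (1 - (tanh (R / 2))\<^sup>2)"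
    unfolding t d using \<open>c > 0\<close> by (simp_all add: field_simps power2_eq_square)
qed

lemma hyp_cosh_0: "z \<in> hyp_plane \<Longrightarrow> hyp_cosh 0 z = hyp_time z"
  using hyp_plane_norm_sq[of z] by (simp add: hyp_cosh_def hyp_time_def field_simps)

lemma hyp_dist_0_eq_iff:
  assumes z: "z \<in> hyp_plane" and "0 \<le> R"
  shows "hyp_dist 0 z = R \<longleftrightarrow> cmod z = tanh (R / 2)"
proof -
  have "hyp_dist 0 z = R \<longleftrightarrow> cosh (hyp_dist 0 z) = cosh R"
    using hyp_dist_nonneg[OF zero_in_hyp_plane z] \<open>0 \<le> R\<close> by (metis arcosh_cosh_real)
  also have "\<dots> \<longleftrightarrow> (1 + (cmod z)\<^sup>2) / (1 - (cmod z)\<^sup>2)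
      = (1 + (tanh (R / 2))\<^sup>2) / (1 - (tanh (R / 2))\<^sup>2)"
    by (simp add: cosh_hyp_dist z zero_in_hyp_plane hyp_cosh_0 hyp_time_def
        flip: cosh_sinh_half_tanh(1))
  also have "\<dots> \<longleftrightarrow> (cmod z)\<^sup>2 = (tanh (R / 2))\<^sup>2"
    using hyp_plane_norm_sq[OF z] cosh_sinh_half_tanh(3)[of R] by (auto simp: field_simps)
  also have "\<dots> \<longleftrightarrow> cmod z = tanh (R / 2)"
    using \<open>0 \<le> R\<close> by (simp add: power2_eq_iff_nonneg)
  finally show ?thesis .
qed

lemma circumcircle_0_iff:
  "circumcircle P 0 R \<longleftrightarrow> R > 0 \<and> set P \<subseteq> hyp_plane \<and> (\<forall>z\<in>set P. cmod z = tanh (R / 2))"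
proof -
  have "hyp_circle 0 R = {z \<in> hyp_plane. cmod z = tanh (R / 2)}" if "R > 0"
    using that hyp_dist_0_eq_iff[of _ R] by (intro set_eqI) (simp add: hyp_circle_def, blast)
  then show ?thesis by (auto simp: circumcircle_def zero_in_hyp_plane)
qed

section \<open>Invariance of circumcircles, sides and polygons under isometries\<close>

lemma circumcircle_isometry:
  assumes f: "hyp_isometry f" and P: "circumcircle P c R" and Q: "set Q = f ` set P"
  shows "circumcircle Q (f c) R"
proof -
  have "f z \<in> hyp_plane" if "z \<in> hyp_plane" for z
    using f that by (auto simp: hyp_isometry_def dest: bij_betwE)
  with assms show ?thesis
    by (auto simp: circumcircle_def hyp_circle_def hyp_isometry_def subset_iff)
qed

lemma hyp_side_isometry:
  assumes f: "hyp_isometry f" and P: "set P \<subseteq> hyp_plane" and i: "i < length P"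
  shows "next_vertex (map f P) i = f (next_vertex P i)"
    and "hyp_side (map f P) i = f ` hyp_side P i"
    and "side_length (map f P) i = side_length P i"
proof -
  have len: "Suc i mod length P < length P" using i by (intro mod_less_divisor) auto
  then show n: "next_vertex (map f P) i = f (next_vertex P i)"
    by (simp add: next_vertex_def)
  have "P ! i \<in> hyp_plane" "next_vertex P i \<in> hyp_plane"
    using P i len by (auto simp: next_vertex_def)
  then show "hyp_side (map f P) i = f ` hyp_side P i"
      "side_length (map f P) i = side_length P i"
    using f i n by (simp_all add: hyp_side_def side_length_def hyp_isometry_image_segment
      hyp_isometry_def)
qed

lemma hyp_sides_isometry:
  assumes "hyp_isometry f" and "set P \<subseteq> hyp_plane"
  shows "hyp_sides (map f P) = (\<lambda>s. f ` s) ` hyp_sides P"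
  using hyp_side_isometry(2)[OF assms] unfolding hyp_sides_def by (simp add: image_image)

lemma hyp_polygon_isometry:
  assumes f: "hyp_isometry f" and P: "hyp_polygon n P"
  shows "hyp_polygon n (map f P)"
proof -
  from P have n: "n \<ge> 3" "length P = n" "distinct P" and sub: "set P \<subseteq> hyp_plane"
    and cross: "\<And>i j. i < n \<Longrightarrow> j < n \<Longrightarrow> i \<noteq> j \<Longrightarrow>
        hyp_side P i \<inter> hyp_side P j = {P ! i, next_vertex P i} \<inter> {P ! j, next_vertex P j}"
    by (auto simp: hyp_polygon_def)
  from f have inj: "inj_on f hyp_plane" and surj: "f ` hyp_plane = hyp_plane"
    by (auto simp: hyp_isometry_def bij_betw_def)
  have ver: "P ! i \<in> hyp_plane" "next_vertex P i \<in> hyp_plane" if "i < n" for i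
    using sub n that by (auto simp: next_vertex_def intro!: subsetD[OF sub] nth_mem mod_less_divisor)
  have side: "hyp_side P i \<subseteq> hyp_plane" for i
    by (auto simp: hyp_side_def hyp_segment_def)
  have "hyp_side (map f P) i \<inter> hyp_side (map f P) j
      = {map f P ! i, next_vertex (map f P) i} \<inter> {map f P ! j, next_vertex (map f P) j}"
    if ij: "i < n" "j < n" "i \<noteq> j" for i j
  proof -
    have "hyp_side (map f P) i \<inter> hyp_side (map f P) j = f ` (hyp_side P i \<inter> hyp_side P j)"
      using ij n by (simp add: hyp_side_isometry f sub inj_on_image_Int[OF inj side side])
    also have "\<dots> = f ` {P ! i, next_vertex P i} \<inter> f ` {P ! j, next_vertex P j}"
      unfolding cross[OF ij] using ver ij by (intro inj_on_image_Int[OF inj]) auto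
    finally show ?thesis
      using ij n by (simp add: hyp_side_isometry f sub)
  qed
  moreover have "distinct (map f P)"
    using n inj sub by (simp add: distinct_map inj_on_subset)
  moreover have "set (map f P) \<subseteq> hyp_plane" using sub surj by auto
  ultimately show ?thesis using n by (simp add: hyp_polygon_def)
qed

text \<open>A centre other than the origin would confine the points of a circle around the origin to a
  line.\<close>

lemma circumcircle_0_unique:
  assumes P: "distinct P" "length P \<ge> 3" and 0: "circumcircle P 0 R" and c: "circumcircle P c R'"
  shows "c = 0" "R' = R"
proof -
  from 0 have R: "R > 0" and pl: "set P \<subseteq> hyp_plane" and r: "\<And>z. z \<in> set P \<Longrightarrow> cmod z = tanh (R / 2)"
    by (auto simp: circumcircle_0_iff)
  from c have cp: "c \<in> hyp_plane" and dist: "\<And>z. z \<in> set P \<Longrightarrow> hyp_dist c z = R'"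
    by (auto simp: circumcircle_def hyp_circle_def)
  show "c = 0"
  proof (rule ccontr)
    assume "c \<noteq> 0"
    \<comment> \<open>Multiplication by \<open>cnj c\<close> turns the direction of \<open>c\<close>
      into the real axis, so \<open>Re (x i)\<close> is the inner product of \<open>c\<close> with
      the vertex.\<close>
    define x where "x i = cnj c * P ! i" for i
    have mem: "P ! i \<in> set P" if "i < 3" for i using P that by auto
    have nx: "cmod (x i) = cmod (x j)" if "i < 3" "j < 3" for i j
      using r[OF mem] that by (simp add: x_def norm_mult)
    have re: "Re (x i) = Re (x j)" if "i < 3" "j < 3" for i j
    proof -
      have ip: "P ! i \<in> hyp_plane" "P ! j \<in> hyp_plane" using mem that pl by auto
      \<comment> \<open>The vertices share one time coordinate, so equal distances to
        \<open>c\<close> leave equal inner products with \<open>c\<close>.\<close>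
      have "hyp_cosh c (P ! i) = hyp_cosh c (P ! j)"
        using dist[OF mem] that ip cp by (metis hyp_dist_eq_iff)
      then have "hyp_space c \<bullet> hyp_space (P ! i) = hyp_space c \<bullet> hyp_space (P ! j)"
        using r[OF mem] that by (simp add: hyp_cosh_hyperboloid cp ip hyp_time_def)
      then have "c \<bullet> P ! i = c \<bullet> P ! j"
        using hyp_plane_norm_sq[OF cp] hyp_plane_norm_sq[OF ip(1)] r[OF mem] that
        by (simp add: hyp_space_def)
      then show ?thesis by (simp add: x_def inner_complex_def)
    qed
    have im: "Im (x i) = Im (x j) \<or> Im (x i) = - Im (x j)" if "i < 3" "j < 3" for i j
    proof -
      have "(Im (x i))\<^sup>2 = (Im (x j))\<^sup>2"
        using nx[OF that] re[OF that] by (metis cmod_power2 add_left_cancel)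
      then show ?thesis by (simp add: power2_eq_iff)
    qed
    have ne: "Im (x i) \<noteq> Im (x j)" if "i < 3" "j < 3" "i \<noteq> j" for i j
    proof
      assume "Im (x i) = Im (x j)"
      with re[OF that(1,2)] have "x i = x j" by (rule complex_eqI)
      then have "P ! i = P ! j" using \<open>c \<noteq> 0\<close> by (simp add: x_def)
      moreover have "i < length P" "j < length P" using P(2) that by auto
      ultimately show False using P(1) \<open>i \<noteq> j\<close> nth_eq_iff_index_eq by blast
    qed
    \<comment> \<open>Three real numbers that agree up to sign cannot be pairwise distinct.\<close>
    show False using im[of 0 1] im[of 0 2] im[of 1 2] ne[of 0 1] ne[of 0 2] ne[of 1 2] by auto
  qed
  moreover have "hd P \<in> set P" using P by (intro hd_in_set) auto
  moreover have "hyp_dist 0 (hd P) = R" if "hd P \<in> set P"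
    using 0 that by (auto simp: circumcircle_def hyp_circle_def)
  ultimately show "R' = R" using dist by simp
qed

text \<open>Moving the centre \<open>c\<close> to the origin reduces the uniqueness behind
  \<open>THE\<close> to the case of a circumcircle about 0.\<close>

lemma circumradius_eq:
  assumes P: "hyp_polygon n P" and c: "circumcircle P c R"
  shows "circumradius P = R"
  unfolding circumradius_def
proof (rule the_equality)
  show "\<exists>c. circumcircle P c R" using c by blast
  fix R' assume "\<exists>c. circumcircle P c R'"
  then obtain c' where c': "circumcircle P c' R'" by blast
  let ?f = "Moebius_function 0 c"
  have f: "hyp_isometry ?f"
    using c by (simp add: hyp_isometry_Moebius circumcircle_def)
  have "hyp_polygon n (map ?f P)" using hyp_polygon_isometry[OF f P] .
  moreover have "circumcircle (map ?f P) 0 R"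
    using circumcircle_isometry[OF f c] by (simp add: Moebius_function_eq_zero)
  moreover have "circumcircle (map ?f P) (?f c') R'"
    using circumcircle_isometry[OF f c'] by simp
  ultimately show "R' = R"
    unfolding hyp_polygon_def by (intro circumcircle_0_unique(2)[of "map ?f P"]) auto
qed

text \<open>The right-hand side mentions only the set of sides, so an isometry that matches sides
  also matches vertices, whatever their labelling. Simplicity gives one inclusion; for the other, a
  vertex lies on the side that ends there and on the side that starts there.\<close>

lemma hyp_polygon_set_eq:
  assumes "hyp_polygon n P"
  shows "set P = \<Union> {s \<inter> t |s t. s \<in> hyp_sides P \<and> t \<in> hyp_sides P \<and> s \<noteq> t}"
proof -
  from assms have n: "n \<ge> 3" "length P = n" "distinct P" and sub: "set P \<subseteq> hyp_plane"
    and cross: "\<And>i j. i < n \<Longrightarrow> j < n \<Longrightarrow> i \<noteq> j \<Longrightarrow>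
        hyp_side P i \<inter> hyp_side P j = {P ! i, next_vertex P i} \<inter> {P ! j, next_vertex P j}"
    by (auto simp: hyp_polygon_def)
  have lt: "Suc i mod n < n" for i using n(1) by (intro mod_less_divisor) auto
  have ends: "P ! i \<in> hyp_side P i" "next_vertex P i \<in> hyp_side P i" if "i < n" for i
  proof -
    have "P ! i \<in> hyp_plane" "next_vertex P i \<in> hyp_plane"
      using n that lt[of i] by (auto simp: next_vertex_def simp del: mod_less_divisor
        intro!: subsetD[OF sub] nth_mem)
    then show "P ! i \<in> hyp_side P i" "next_vertex P i \<in> hyp_side P i"
      by (simp_all add: hyp_side_def hyp_segment_def hyp_dist_def)
  qed
  show ?thesis
  proof (intro equalityI subsetI)
    fix v assume "v \<in> set P"
    then obtain k where k: "k < n" "v = P ! k" using n by (metis in_set_conv_nth)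
    \<comment> \<open>The index before \<open>k\<close> in cyclic order; adding \<open>n - 1\<close>
      avoids a truncated subtraction at \<open>k = 0\<close>.\<close>
    define j where "j = (k + (n - 1)) mod n"
    have j: "j < n" using n by (simp add: j_def)
    have sj: "Suc j mod n = k"
    proof -
      have "Suc j mod n = Suc (k + (n - 1)) mod n" by (simp add: j_def mod_Suc_eq)
      also have "Suc (k + (n - 1)) = k + n" using n by simp
      finally show ?thesis using k by simp
    qed
    \<comment> \<open>As \<open>n \<ge> 3\<close>, the predecessor of \<open>k\<close> is not also
      its successor. Hence \<open>P ! j\<close> is not an endpoint of side \<open>k\<close>, and the
      two sides differ.\<close>
    have "j \<noteq> k" "Suc k mod n \<noteq> j"
      using sj n j by (auto simp: mod_Suc split: if_splits)
    then have neq: "P ! j \<noteq> P ! k" "P ! j \<noteq> next_vertex P k"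
      using n j k lt[of k] by (auto simp: next_vertex_def nth_eq_iff_index_eq)
    have nj: "next_vertex P j = v" using sj n k by (simp add: next_vertex_def)
    have "hyp_side P j \<noteq> hyp_side P k"
      using cross[OF j k(1) \<open>j \<noteq> k\<close>] neq ends(1)[OF j] by auto
    moreover have "v \<in> hyp_side P j \<inter> hyp_side P k"
      using ends(1)[OF k(1)] ends(2)[OF j] nj k by simp
    moreover have "hyp_side P j \<in> hyp_sides P" "hyp_side P k \<in> hyp_sides P"
      using j k n by (auto simp: hyp_sides_def)
    ultimately show "v \<in> \<Union> {s \<inter> t |s t. s \<in> hyp_sides P \<and> t \<in> hyp_sides P \<and> s \<noteq> t}"
      by blast
  next
    fix v assume "v \<in> \<Union> {s \<inter> t |s t. s \<in> hyp_sides P \<and> t \<in> hyp_sides P \<and> s \<noteq> t}"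
    then obtain i j where ij: "i < n" "j < n" "i \<noteq> j" "v \<in> hyp_side P i \<inter> hyp_side P j"
      using n by (auto simp: hyp_sides_def)
    then have "v = P ! i \<or> v = P ! (Suc i mod n)"
      using cross[OF ij(1-3)] n by (auto simp: next_vertex_def)
    moreover have "P ! (Suc i mod n) \<in> set P" using lt[of i] n(2) by (metis nth_mem)
    ultimately show "v \<in> set P" using ij(1) n(2) by (metis nth_mem)
  qed
qed

text \<open>Since the sides determine the vertices, \<open>f\<close> carries the vertices of
  \<open>P\<close> onto those of \<open>Q\<close>, and so a circumcircle to a circumcircle of the
  same radius.\<close>

lemma isometric_polygons_circumradius_eq:
  assumes P: "hyp_polygon n P" and cP: "cyclic_polygon P" and Q: "hyp_polygon n Q"
    and "isometric_polygons P Q"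
  shows "circumradius P = circumradius Q"
proof -
  obtain f where f: "hyp_isometry f" and sides: "(\<lambda>s. f ` s) ` hyp_sides P = hyp_sides Q"
    using assms(4) by (auto simp: isometric_polygons_def)
  have inj: "inj_on f hyp_plane" using f by (simp add: hyp_isometry_def bij_betw_def)
  have sub: "s \<subseteq> hyp_plane" if "s \<in> hyp_sides P" for s
    using that by (auto simp: hyp_sides_def hyp_side_def hyp_segment_def)
  \<comment> \<open>Injectivity on the disc keeps distinct sides distinct and lets images commute
    with intersections.\<close>
  have int: "f ` (s \<inter> t) = f ` s \<inter> f ` t" "f ` s = f ` t \<longleftrightarrow> s = t"
    if "s \<in> hyp_sides P" "t \<in> hyp_sides P" for s t
    using that sub inj by (auto intro!: inj_on_image_Int[OF inj] simp: inj_on_image_eq_iff[OF inj])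
  have "set Q = \<Union> {f ` s \<inter> f ` t |s t. s \<in> hyp_sides P \<and> t \<in> hyp_sides P \<and> f ` s \<noteq> f ` t}"
    unfolding hyp_polygon_set_eq[OF Q] sides[symmetric] by blast
  also have "{f ` s \<inter> f ` t |s t. s \<in> hyp_sides P \<and> t \<in> hyp_sides P \<and> f ` s \<noteq> f ` t}
      = {f ` (s \<inter> t) |s t. s \<in> hyp_sides P \<and> t \<in> hyp_sides P \<and> s \<noteq> t}"
    using int by (metis (no_types, opaque_lifting))
  also have "\<Union> \<dots> = f ` \<Union> {s \<inter> t |s t. s \<in> hyp_sides P \<and> t \<in> hyp_sides P \<and> s \<noteq> t}"
    by blast
  finally have *: "set Q = f ` set P" by (simp flip: hyp_polygon_set_eq[OF P])
  obtain c R where c: "circumcircle P c R" using cP by (auto simp: cyclic_polygon_def)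
  show ?thesis
    using circumradius_eq[OF P c] circumradius_eq[OF Q circumcircle_isometry[OF f c *]] by simp
qed

section \<open>Strict convexity of the perimeter\<close>

text \<open>On the positive half-line the derivative of \<open>arsinh (a * sinh t)\<close> is
  strictly increasing, so the graph lies strictly above its tangent at \<open>y\<close> away from
  \<open>y\<close>.\<close>

lemma arsinh_sinh_tangent:
  fixes a x y :: real
  assumes a: "0 < a" "a < 1" and x: "0 < x" and y: "0 < y" and "x \<noteq> y"
  shows "arsinh (a * sinh y) + a * cosh y / sqrt (1 + (a * sinh y)\<^sup>2) * (x - y) < arsinh (a * sinh x)"
proof -
  define f f' where "f t = arsinh (a * sinh t)" and "f' t = a * cosh t / sqrt (1 + (a * sinh t)\<^sup>2)"
    for t :: real
  have sq: "0 < 1 + (a * sinh t)\<^sup>2" for t by (smt (verit) zero_le_power2)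
  have deriv: "(f has_real_derivative f' t) (at t)" for t
    unfolding f_def f'_def proof -
    have "((\<lambda>t. a * sinh t) has_real_derivative a * cosh t) (at t)"
      by (auto intro!: derivative_eq_intros)
    from DERIV_chain2[OF arsinh_real_has_field_derivative this]
    show "((\<lambda>t. arsinh (a * sinh t)) has_real_derivative a * cosh t / sqrt (1 + (a * sinh t)\<^sup>2)) (at t)"
      by (simp add: add.commute)
  qed
  have mono: "f' s < f' t" if "0 < s" "s < t" for s t
  proof (rule power2_less_imp_less)
    \<comment> \<open>In this form the square visibly grows with the square of
      \<open>sinh r\<close>, because \<open>a < 1\<close> makes the numerator 1 - a^2
      positive.\<close>
    have f'2: "(f' r)\<^sup>2 = 1 - (1 - a\<^sup>2) / (1 + (a * sinh r)\<^sup>2)" for r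
    proof -
      have "(f' r)\<^sup>2 = a\<^sup>2 * (sinh r ^ 2 + 1) / (1 + (a * sinh r)\<^sup>2)"
        using sq[of r] by (simp add: f'_def power_divide power_mult_distrib cosh_square_eq)
      also have "\<dots> = ((1 + (a * sinh r)\<^sup>2) - (1 - a\<^sup>2)) / (1 + (a * sinh r)\<^sup>2)"
        by (simp add: power_mult_distrib algebra_simps)
      also have "\<dots> = 1 - (1 - a\<^sup>2) / (1 + (a * sinh r)\<^sup>2)"
        using sq[of r] by (subst diff_divide_distrib) auto
      finally show ?thesis .
    qed
    have "sinh s < sinh t" "0 < sinh s" using that by auto
    then have "(a * sinh s)\<^sup>2 < (a * sinh t)\<^sup>2"
      using a by (intro power_strict_mono) auto
    then show "(f' s)\<^sup>2 < (f' t)\<^sup>2"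
      unfolding f'2 using sq[of s] a by (simp add: power_less_one_iff divide_strict_left_mono)
    show "0 \<le> f' t" using a by (simp add: f'_def)
  qed
  have "f y + f' y * (x - y) < f x"
  proof (cases "x < y")
    case True
    then obtain z where z: "x < z" "z < y" "f y - f x = (y - x) * f' z"
      using MVT2[OF True, of f f'] deriv by blast
    have "(y - x) * f' z < (y - x) * f' y" using True z mono[of z y] x by auto
    with z show ?thesis by (simp add: algebra_simps)
  next
    case False
    with \<open>x \<noteq> y\<close> have "y < x" by simp
    then obtain z where z: "y < z" "z < x" "f x - f y = (x - y) * f' z"
      using MVT2[of y x f f'] deriv by blast
    have "(x - y) * f' y < (x - y) * f' z" using \<open>y < x\<close> z mono[of y z] y by auto
    with z show ?thesis by (simp add: algebra_simps)
  qed
  then show ?thesis by (simp add: f_def f'_def)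
qed

text \<open>Jensen's inequality by summing the tangent lines at the mean \<open>m\<close>: their
  linear terms cancel, and a single \<open>R i\<close> different from \<open>m\<close> makes the sum
  strict.\<close>

lemma sum_arsinh_sinh_ge:
  fixes a :: real and R :: "'i \<Rightarrow> real"
  assumes a: "0 < a" "a < 1" and I: "finite I" "I \<noteq> {}" and R: "\<And>i. i \<in> I \<Longrightarrow> 0 < R i"
  defines "m \<equiv> (\<Sum>i\<in>I. R i) / card I"
  shows "card I * arsinh (a * sinh m) \<le> (\<Sum>i\<in>I. arsinh (a * sinh (R i)))"
    and "(\<Sum>i\<in>I. arsinh (a * sinh (R i))) = card I * arsinh (a * sinh m) \<longleftrightarrow> (\<forall>i\<in>I. R i = m)"
proof -
  have cI: "0 < card I" using I by (simp add: card_gt_0_iff)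
  have "0 < m" unfolding m_def using I R cI by (intro divide_pos_pos sum_pos) auto
  define d where "d = a * cosh m / sqrt (1 + (a * sinh m)\<^sup>2)"
  define g where "g i = arsinh (a * sinh m) + d * (R i - m)" for i
  have sum_R: "(\<Sum>i\<in>I. R i) = card I * m"
    using cI by (simp add: m_def)
  have sum_g: "(\<Sum>i\<in>I. g i) = card I * arsinh (a * sinh m)"
    by (simp add: g_def sum.distrib sum_subtractf sum_R flip: sum_distrib_left)
  have lt: "g i < arsinh (a * sinh (R i))" if "i \<in> I" "R i \<noteq> m" for i
    using arsinh_sinh_tangent[OF a R[OF that(1)] \<open>0 < m\<close> that(2)] by (simp add: g_def d_def)
  have eq: "g i = arsinh (a * sinh (R i))" if "R i = m" for i
    using that by (simp add: g_def)
  have le: "g i \<le> arsinh (a * sinh (R i))" if "i \<in> I" for i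
    using lt[OF that] eq[of i] by fastforce
  show "card I * arsinh (a * sinh m) \<le> (\<Sum>i\<in>I. arsinh (a * sinh (R i)))"
    unfolding sum_g[symmetric] using le by (rule sum_mono)
  show "(\<Sum>i\<in>I. arsinh (a * sinh (R i))) = card I * arsinh (a * sinh m) \<longleftrightarrow> (\<forall>i\<in>I. R i = m)"
  proof
    assume *: "(\<Sum>i\<in>I. arsinh (a * sinh (R i))) = card I * arsinh (a * sinh m)"
    show "\<forall>i\<in>I. R i = m"
    proof (rule ccontr)
      assume "\<not> (\<forall>i\<in>I. R i = m)"
      then have "sum g I < (\<Sum>i\<in>I. arsinh (a * sinh (R i)))"
        using I lt le by (intro sum_strict_mono_ex1) auto
      with * sum_g show False by simp
    qed
  qed simp
qed

section \<open>Crossing chords of a regular polygon\<close>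

text \<open>On the hyperboloid all four endpoints have the same time coordinate. The weights add up
  to \<open>l + m\<close> on both sides, so the hypothesis makes two combinations equal in Minkowski
  space; scaled onto the hyperboloid they give a common point of the segments.\<close>

lemma hyp_segments_cross:
  assumes r: "0 < r" "r < 1" "cmod a = r" "cmod b = r" "cmod a' = r" "cmod b' = r"
    and lm: "0 < l" "0 < m" and eq: "l *\<^sub>R a + m *\<^sub>R b = m *\<^sub>R a' + l *\<^sub>R b'"
  shows "hyp_segment a b \<inter> hyp_segment a' b' \<noteq> {}"
proof -
  define t q where "t = (1 + r\<^sup>2) / (1 - r\<^sup>2)" and "q = 2 / (1 - r\<^sup>2)"
  have r2: "0 < 1 - r\<^sup>2" using r by (simp add: power_less_one_iff)
  have coords: "z \<in> hyp_plane" "hyp_time z = t" "hyp_space z = q *\<^sub>R z" if "cmod z = r" for z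
    using that r by (simp_all add: hyp_plane_iff hyp_time_def hyp_space_def t_def q_def)
  have "0 < t" "0 < q" using r2 by (auto simp: t_def q_def intro!: divide_pos_pos add_pos_nonneg)
  have tq: "t\<^sup>2 - (q * r)\<^sup>2 = 1"
  proof -
    have "t\<^sup>2 - (q * r)\<^sup>2 = ((1 + r\<^sup>2)\<^sup>2 - (2 * r)\<^sup>2) / (1 - r\<^sup>2)\<^sup>2"
      by (simp add: t_def q_def power_divide diff_divide_distrib)
    also have "(1 + r\<^sup>2)\<^sup>2 - (2 * r)\<^sup>2 = (1 - r\<^sup>2)\<^sup>2" by (simp add: power2_eq_square algebra_simps)
    finally show ?thesis using r2 by simp
  qed
  define y where "y = q *\<^sub>R (l *\<^sub>R a + m *\<^sub>R b)"
  \<comment> \<open>The Minkowski square of the combination. The triangle inequality and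
    \<open>tq\<close> bound it below by the square of \<open>l + m\<close>, so the vector is
    timelike and can be normalised by \<open>s\<close>.\<close>
  define N where "N = ((l + m) * t)\<^sup>2 - (cmod y)\<^sup>2"
  have "cmod (l *\<^sub>R a + m *\<^sub>R b) \<le> (l + m) * r"
    using norm_triangle_ineq[of "l *\<^sub>R a" "m *\<^sub>R b"] r lm by (simp add: algebra_simps)
  then have "cmod y \<le> (l + m) * (q * r)"
    using \<open>0 < q\<close> by (simp add: y_def mult.left_commute)
  then have "(cmod y)\<^sup>2 \<le> ((l + m) * (q * r))\<^sup>2" by (intro power_mono) auto
  moreover have "((l + m) * t)\<^sup>2 - ((l + m) * (q * r))\<^sup>2 = (l + m)\<^sup>2"
    using tq by (simp add: power_mult_distrib flip: right_diff_distrib)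
  moreover have "0 < (l + m)\<^sup>2" using lm by simp
  ultimately have "0 < N" unfolding N_def by linarith
  define s where "s = 1 / sqrt N"
  have "0 < s" and s2: "s\<^sup>2 = 1 / N" using \<open>0 < N\<close> by (simp_all add: s_def power_divide)
  have "(s * ((l + m) * t))\<^sup>2 - (cmod (s *\<^sub>R y))\<^sup>2 = s\<^sup>2 * N"
    by (simp add: N_def power_mult_distrib right_diff_distrib)
  then have "(s * ((l + m) * t))\<^sup>2 - (cmod (s *\<^sub>R y))\<^sup>2 = 1" using s2 \<open>0 < N\<close> by simp
  then obtain x where x: "x \<in> hyp_plane" "hyp_time x = s * ((l + m) * t)" "hyp_space x = s *\<^sub>R y"
    using hyperboloid_point_exists[of "s * ((l + m) * t)" "s *\<^sub>R y"] \<open>0 < s\<close> \<open>0 < t\<close> lm by auto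
  have "x \<in> hyp_segment a b"
    by (rule in_hyp_segment_hyperboloid[of _ _ _ "s * l" "s * m"])
      (use r lm \<open>0 < s\<close> x in \<open>auto simp: coords y_def algebra_simps\<close>)
  moreover have "x \<in> hyp_segment a' b'"
  proof (rule in_hyp_segment_hyperboloid[of _ _ _ "s * m" "s * l"])
    have "hyp_space x = s *\<^sub>R q *\<^sub>R (m *\<^sub>R a' + l *\<^sub>R b')" using x eq by (simp add: y_def)
    then show "hyp_space x = (s * m) *\<^sub>R hyp_space a' + (s * l) *\<^sub>R hyp_space b'"
      using r by (simp add: coords algebra_simps)
  qed (use r lm \<open>0 < s\<close> x in \<open>auto simp: coords algebra_simps\<close>)
  ultimately show ?thesis by blast
qed

section \<open>Roots of unity and the intersection of their chords\<close>

definition unity_root :: "nat \<Rightarrow> nat \<Rightarrow> complex" where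
  "unity_root n k = cis (2 * pi * real k / real n)"

lemma norm_unity_root [simp]: "cmod (unity_root n k) = 1"
  by (simp add: unity_root_def)

lemma unity_root_power: "unity_root n k ^ i = unity_root n (k * i)"
  by (simp add: unity_root_def Complex.DeMoivre algebra_simps)

lemma unity_root_add: "unity_root n (j + k) = unity_root n j * unity_root n k"
  by (simp add: unity_root_def cis_mult ring_distribs add_divide_distrib)

lemma bij_betw_unity_root: "n > 0 \<Longrightarrow> bij_betw (unity_root n) {..<n} {z. z ^ n = 1}"
  using Complex.bij_betw_roots_unity[of n] by (simp add: unity_root_def[abs_def])

lemma unity_root_0 [simp]: "unity_root n 0 = 1"
  by (simp add: unity_root_def)

lemma unity_root_eq_iff:
  "i < n \<Longrightarrow> j < n \<Longrightarrow> unity_root n i = unity_root n j \<longleftrightarrow> i = j"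
  using bij_betw_unity_root[of n] by (auto simp: bij_betw_def inj_on_def)

lemma unity_root_power_eq_1: "n > 0 \<Longrightarrow> unity_root n k ^ n = 1"
  using Complex.bij_betw_roots_unity[of n]
  by (simp add: unity_root_def Complex.DeMoivre cis_multiple_2pi)

lemma unity_root_cnj:
  assumes "n > 0" "k \<le> n"
  shows "cnj (unity_root n k) = unity_root n (n - k)"
proof -
  have "unity_root n (n - k) * unity_root n k = unity_root n n"
    using assms by (simp flip: unity_root_add)
  also have "\<dots> = 1" using assms by (simp add: unity_root_def)
  finally have "unity_root n (n - k) = inverse (unity_root n k)"
    by (metis inverse_unique mult.commute)
  then show ?thesis by (simp add: unity_root_def cis_cnj)
qed

text \<open>The chords from 1 to \<open>unity_root n m\<close> and from
  \<open>unity_root n 1\<close> to \<open>unity_root n (m + 1)\<close> are mirror images in the line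
  of argument (m + 1) pi / n. The weights place the left-hand side on that line, so it equals its
  mirror image; the bounds on \<open>m\<close> make both sines positive.\<close>

lemma unity_root_chords_cross:
  assumes m: "2 \<le> m" "m + 1 < n"
  defines "l \<equiv> sin ((real m - 1) * pi / n)" and "l' \<equiv> sin ((real m + 1) * pi / n)"
  shows "0 < l" "0 < l'"
    and "l *\<^sub>R 1 + l' *\<^sub>R unity_root n m = l' *\<^sub>R unity_root n 1 + l *\<^sub>R unity_root n (m + 1)"
proof -
  have n: "0 < real n" using m by simp
  show "0 < l" "0 < l'"
  proof -
    have "pi * (real m + 1) < pi * real n" "pi * 1 < pi * real m" "0 < pi * (real m + 1)"
      using m by (auto intro!: mult_strict_left_mono mult_pos_pos)
    then show "0 < l" "0 < l'"
      unfolding l_def l'_def using n pi_gt_zero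
      by (auto intro!: sin_gt_zero simp: field_simps simp del: pi_gt_zero)
  qed
  \<comment> \<open>\<open>A\<close> is the argument of the mirror line; measured from that line, 1
    lies at angle \<open>- A\<close> and \<open>unity_root n m\<close> at angle
    \<open>B\<close>.\<close>
  define A B where "A = (real m + 1) * pi / n" and "B = (real m - 1) * pi / n"
  have r: "unity_root n 1 = cis (A - B)" "unity_root n m = cis (A + B)" "unity_root n (m + 1) = cis (2 * A)"
    unfolding unity_root_def A_def B_def using m n
    by (intro arg_cong[where f = cis]; simp add: of_nat_diff field_simps)+
  have "l = sin B" "l' = sin A" by (simp_all add: l_def l'_def A_def B_def)
  then show "l *\<^sub>R 1 + l' *\<^sub>R unity_root n m = l' *\<^sub>R unity_root n 1 + l *\<^sub>R unity_root n (m + 1)"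
    unfolding r by (simp add: complex_eq_iff cos_add cos_diff sin_add sin_diff cos_double_sin sin_double)
      (simp add: power2_eq_square algebra_simps)
qed

section \<open>Regular polygons inscribed in a circle\<close>

text \<open>For \<open>m \<ge> 2\<close> the list \<open>W\<close> runs through the star polygon \<open>{n/m}\<close>. The side from exponent
  \<open>0\<close> to \<open>m\<close> then meets the one from \<open>1\<close> to \<open>m + 1\<close>.\<close>

lemma star_polygon_simple:
  assumes W: "hyp_polygon n W" and r: "0 < r" "r < 1" "cmod (W ! 0) = r"
    and pow: "\<And>i. i < n \<Longrightarrow> W ! i = W ! 0 * unity_root n m ^ i"
    and m: "0 < m" "2 * m \<le> n"
  shows "m = 1"
proof (rule ccontr)
  assume "m \<noteq> 1"
  with m have m2: "2 \<le> m" by simp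
  from W have n: "n \<ge> 3" "length W = n" "distinct W"
    and cross: "\<And>i j. i < n \<Longrightarrow> j < n \<Longrightarrow> i \<noteq> j \<Longrightarrow>
        hyp_side W i \<inter> hyp_side W j = {W ! i, next_vertex W i} \<inter> {W ! j, next_vertex W j}"
    by (auto simp: hyp_polygon_def)
  have n0: "n > 0" using n by simp
  have W0: "W ! 0 \<noteq> 0" using r by auto
  have inj: "inj_on (\<lambda>i. unity_root n m ^ i) {..<n}"
  proof (rule inj_onI)
    fix i j assume ij: "i \<in> {..<n}" "j \<in> {..<n}" "unity_root n m ^ i = unity_root n m ^ j"
    then have "W ! i = W ! j" using pow[of i] pow[of j] by (metis lessThan_iff)
    then show "i = j" using ij n by (simp add: nth_eq_iff_index_eq)
  qed
  \<comment> \<open>For \<open>2 * m = n\<close> the list would be back at its first vertex after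
    two steps.\<close>
  have "2 * m \<noteq> n"
  proof
    assume "2 * m = n"
    then have "unity_root n m ^ 2 = unity_root n 1 ^ n"
      by (simp add: unity_root_power mult.commute)
    then have "unity_root n m ^ 2 = unity_root n m ^ 0"
      using unity_root_power_eq_1[OF n0] by simp
    then show False using inj_onD[OF inj, of 2 0] n by simp
  qed
  with m have mn: "m + 1 < n" using n by simp
  have next_W: "next_vertex W i = W ! 0 * unity_root n m ^ Suc i" if "i < n" for i
  proof (cases "Suc i < n")
    case True
    then show ?thesis using n pow[OF True] by (simp add: next_vertex_def)
  next
    case False
    with that have "Suc i = n" by simp
    then show ?thesis using n unity_root_power_eq_1[OF n0, of m] by (simp add: next_vertex_def)
  qed
  \<comment> \<open>The \<open>n\<close> distinct powers exhaust the roots of unity, so some side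
    \<open>j\<close> starts at exponent 1; by \<open>next_W\<close> it ends at exponent
    \<open>m + 1\<close>.\<close>
  have "(\<lambda>i. unity_root n m ^ i) ` {..<n} = {z. z ^ n = 1}"
  proof (rule card_subset_eq)
    show "finite {z :: complex. z ^ n = 1}" using n0 by (intro finite_roots_unity) simp
    show "(\<lambda>i. unity_root n m ^ i) ` {..<n} \<subseteq> {z. z ^ n = 1}"
      using unity_root_power_eq_1[OF n0] by (auto simp: unity_root_power)
    show "card ((\<lambda>i. unity_root n m ^ i) ` {..<n}) = card {z :: complex. z ^ n = 1}"
      using inj n0 by (simp add: card_image Complex.card_roots_unity_eq)
  qed
  moreover have "unity_root n 1 \<in> {z. z ^ n = 1}"
    using unity_root_power_eq_1[OF n0] by simp
  ultimately obtain j where j: "j < n" "unity_root n m ^ j = unity_root n 1"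
    by (metis (no_types, lifting) imageE lessThan_iff)
  have "j \<noteq> 0"
  proof
    assume "j = 0"
    then show False using j(2) unity_root_eq_iff[of 0 n 1] n(1) by simp
  qed
  have ends: "W ! j = W ! 0 * unity_root n 1" "next_vertex W j = W ! 0 * unity_root n (m + 1)"
    "next_vertex W 0 = W ! 0 * unity_root n m"
    using pow[OF j(1)] next_W[OF j(1)] next_W[OF n0] j unity_root_add[of n m 1]
    by (simp_all add: mult_ac)
  have "hyp_segment (W ! 0) (next_vertex W 0) \<inter> hyp_segment (W ! j) (next_vertex W j) \<noteq> {}"
    unfolding ends
  proof (rule hyp_segments_cross[where l = "sin ((real m - 1) * pi / n)" and m = "sin ((real m + 1) * pi / n)"])
    have "W ! 0 * (sin ((real m - 1) * pi / n) *\<^sub>R 1 + sin ((real m + 1) * pi / n) *\<^sub>R unity_root n m)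
        = W ! 0 * (sin ((real m + 1) * pi / n) *\<^sub>R unity_root n 1 + sin ((real m - 1) * pi / n) *\<^sub>R unity_root n (m + 1))"
      using unity_root_chords_cross(3)[OF m2 mn] by simp
    then show "sin ((real m - 1) * pi / n) *\<^sub>R W ! 0 + sin ((real m + 1) * pi / n) *\<^sub>R (W ! 0 * unity_root n m)
        = sin ((real m + 1) * pi / n) *\<^sub>R (W ! 0 * unity_root n 1)
          + sin ((real m - 1) * pi / n) *\<^sub>R (W ! 0 * unity_root n (m + 1))"
      by (simp add: distrib_left)
  qed (use r unity_root_chords_cross(1,2)[OF m2 mn] in \<open>simp_all add: norm_mult\<close>)
  \<comment> \<open>By simplicity the crossing sides would have to share an endpoint, but the
    exponents 0 and \<open>m\<close> differ from 1 and \<open>m + 1\<close>, and all of them are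
    below \<open>n\<close>.\<close>
  then have "{W ! 0, next_vertex W 0} \<inter> {W ! j, next_vertex W j} \<noteq> {}"
    using cross[OF n0 j(1)] \<open>j \<noteq> 0\<close> by (simp add: hyp_side_def)
  moreover have "unity_root n i \<noteq> unity_root n k" if "i \<in> {0, m}" "k \<in> {1, m + 1}" for i k
    using that unity_root_eq_iff[of i n k] m2 mn by auto
  from this[of 0 1] this[of 0 "m + 1"] this[of m 1] this[of m "m + 1"]
  have "{W ! 0, next_vertex W 0} \<inter> {W ! j, next_vertex W j} = {}"
    unfolding ends using W0 by auto
  ultimately show False by simp
qed

text \<open>The quotient \<open>q i\<close> of consecutive vertices lies on the unit circle, and
  equal chords fix its real part. It could only change into its conjugate, which would lead back to
  an earlier vertex; so it is constant, and closing up after \<open>n\<close> steps makes it an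
  \<open>n\<close>-th root of unity.\<close>

lemma inscribed_equilateral_powers:
  assumes n: "n \<ge> 3" "length W = n" "distinct W" and "0 < r"
    and r: "\<And>i. i < n \<Longrightarrow> cmod (W ! i) = r"
    and d: "\<And>i. i < n \<Longrightarrow> cmod (W ! i - next_vertex W i) = d"
  obtains m where "0 < m" "m < n" "\<And>i. i < n \<Longrightarrow> W ! i = W ! 0 * unity_root n m ^ i"
proof -
  \<comment> \<open>Vertices are indexed cyclically, so the closing side needs no separate
    case.\<close>
  define w where "w i = W ! (i mod n)" for i
  define q where "q i = w (Suc i) / w i" for i
  have n0: "n > 0" using n by simp
  have lt: "i mod n < n" for i using n0 by simp
  have nw: "cmod (w i) = r" for i using r[OF lt] by (simp add: w_def)
  then have w0: "w i \<noteq> 0" for i using \<open>0 < r\<close> by (metis norm_zero less_irrefl)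
  have step: "w (Suc i) = w i * q i" for i using w0 by (simp add: q_def)
  have nq: "cmod (q i) = 1" for i using nw \<open>0 < r\<close> by (simp add: q_def norm_divide)
  have "cmod (q i - 1) = d / r" for i
  proof -
    have "q i - 1 = (w (Suc i) - w i) / w i" using w0 by (simp add: q_def diff_divide_distrib)
    moreover have "cmod (w (Suc i) - w i) = d"
      using d[OF lt[of i]] n by (simp add: w_def next_vertex_def mod_Suc_eq norm_minus_commute)
    ultimately show ?thesis by (simp add: norm_divide nw)
  qed
  moreover have "(cmod (q i - 1))\<^sup>2 = 2 - 2 * Re (q i)" for i
  proof -
    have "(Re (q i))\<^sup>2 + (Im (q i))\<^sup>2 = 1" using nq[of i] cmod_power2[of "q i"] by simp
    then show ?thesis unfolding cmod_power2 by (simp add: power2_eq_square algebra_simps)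
  qed
  ultimately have re: "Re (q i) = Re (q j)" for i j
    by (metis diff_left_imp_eq mult_cancel_left zero_neq_numeral)
  have const: "q (Suc i) = q i" for i
  proof -
    have "(Im (q (Suc i)))\<^sup>2 = (Im (q i))\<^sup>2"
      using nq[of i] nq[of "Suc i"] re[of "Suc i" i]
      by (metis cmod_power2 add_left_cancel)
    then have "q (Suc i) = q i \<or> q (Suc i) = cnj (q i)"
      using re[of "Suc i" i] by (auto simp: power2_eq_iff complex_eq_iff)
    \<comment> \<open>Opposite turns cancel, and distinctness of the vertices would then make
      \<open>n\<close> divide 2.\<close>
    moreover have "q (Suc i) \<noteq> cnj (q i)"
    proof
      assume "q (Suc i) = cnj (q i)"
      moreover have "q i * cnj (q i) = 1"
        using complex_norm_square[of "q i"] nq[of i] by simp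
      ultimately have "w (Suc (Suc i)) = w i" by (simp add: step mult.assoc)
      then have "Suc (Suc i) mod n = i mod n"
        using n lt by (simp add: w_def nth_eq_iff_index_eq)
      then have "n dvd Suc (Suc i) - i" by (metis mod_eq_dvd_iff_nat le_SucI le_refl)
      then show False using n by (auto dest: dvd_imp_le)
    qed
    ultimately show ?thesis by blast
  qed
  have q: "q i = q 0" for i by (induction i) (simp_all add: const)
  have w: "w i = w 0 * q 0 ^ i" for i
  proof (induction i)
    case (Suc i)
    then show ?case by (simp add: step[of i] q[of i] mult.assoc mult.commute[of "q 0"])
  qed simp
  have "w n = w 0" by (simp add: w_def)
  with w[of n] w0[of 0] have "q 0 ^ n = 1" by simp
  then have "q 0 \<in> unity_root n ` {..<n}"
    using bij_betw_unity_root[OF n0] by (simp add: bij_betw_def)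
  then obtain m where m: "m < n" "q 0 = unity_root n m" by auto
  show thesis
  proof
    show "m < n" by fact
    show "W ! i = W ! 0 * unity_root n m ^ i" if "i < n" for i
      using w[of i] that m by (simp add: w_def)
    show "0 < m"
    proof (rule ccontr)
      assume "\<not> 0 < m"
      then have "w 1 = w 0" using w[of 1] m by simp
      then show False using n by (simp add: w_def nth_eq_iff_index_eq)
    qed
  qed
qed

section \<open>Normal form, congruence and perimeter of regular polygons\<close>

definition regular_vertices :: "nat \<Rightarrow> real \<Rightarrow> complex list" where
  "regular_vertices n R = map (\<lambda>i. of_real (tanh (R / 2)) * unity_root n i) [0..<n]"

text \<open>A Moebius map moves \<open>c\<close> to the origin, a rotation puts the first vertex on
  the positive real axis, and conjugation is added if the vertices run clockwise. Simplicity then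
  leaves only the step to the adjacent root of unity.\<close>

lemma regular_polygon_normal_form:
  assumes P: "hyp_polygon n P" and c: "circumcircle P c R"
    and eq: "\<And>i j. i < n \<Longrightarrow> j < n \<Longrightarrow> side_length P i = side_length P j"
  obtains f where "hyp_isometry f" "map f P = regular_vertices n R"
proof -
  define f where "f = Moebius_function 0 c"
  have f: "hyp_isometry f"
    using c by (simp add: f_def hyp_isometry_Moebius circumcircle_def)
  define W where "W = map f P"
  define r where "r = tanh (R / 2)"
  have sub: "set P \<subseteq> hyp_plane" and len: "length P = n" using P by (auto simp: hyp_polygon_def)
  have W: "hyp_polygon n W" unfolding W_def by (rule hyp_polygon_isometry[OF f P])
  then have n: "n \<ge> 3" "length W = n" "distinct W" and Wp: "set W \<subseteq> hyp_plane"
    by (auto simp: hyp_polygon_def)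
  have n0: "0 < n" using n by simp
  have "circumcircle W 0 R"
    using circumcircle_isometry[OF f c, of W] by (simp add: W_def f_def Moebius_function_eq_zero)
  then have R: "R > 0" and r: "\<And>i. i < n \<Longrightarrow> cmod (W ! i) = r"
    using n by (auto simp: circumcircle_0_iff r_def)
  have r01: "0 < r" "r < 1" using R by (simp_all add: r_def tanh_real_lt_1)
  have pl: "W ! i \<in> hyp_plane" "next_vertex W i \<in> hyp_plane" "cmod (next_vertex W i) = r"
    if "i < n" for i
    using that r r01 n0 n by (auto simp: hyp_plane_iff next_vertex_def)
  \<comment> \<open>All endpoints have the same modulus \<open>r\<close>, so equal hyperbolic
    distances mean equal Euclidean chords.\<close>
  have d: "cmod (W ! i - next_vertex W i) = cmod (W ! 0 - next_vertex W 0)" if i: "i < n" for i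
  proof -
    have "side_length W i = side_length W 0"
      unfolding W_def using eq[OF i n0] i n0 len by (simp add: hyp_side_isometry f sub)
    then have "hyp_cosh (W ! i) (next_vertex W i) = hyp_cosh (W ! 0) (next_vertex W 0)"
      unfolding side_length_def by (subst (asm) hyp_dist_eq_iff) (use pl i n0 in auto)
    moreover have "r\<^sup>2 < 1" using r01 by (simp add: power_less_one_iff)
    ultimately show ?thesis
      using r pl(3) i n0 by (auto simp: hyp_cosh_def)
  qed
  obtain m where m: "0 < m" "m < n" and pow: "\<And>i. i < n \<Longrightarrow> W ! i = W ! 0 * unity_root n m ^ i"
    using inscribed_equilateral_powers[OF n r01(1) r d] by blast
  define u where "u = of_real r / W ! 0"
  have W0: "cmod (W ! 0) = r" "W ! 0 \<noteq> 0" using r[OF n0] r01 by auto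
  have "cmod u = 1" using W0 r01 by (simp add: u_def norm_divide)
  then have rot: "hyp_isometry ((\<lambda>z. u * z) \<circ> f)"
    by (intro hyp_isometry_comp f hyp_isometry_rotation)
  have uW: "u * W ! i = of_real r * unity_root n m ^ i" if "i < n" for i
    using pow[OF that] W0 by (simp add: u_def)
  show thesis
  proof (cases "2 * m \<le> n")
    case True
    then have "m = 1" using star_polygon_simple[OF W r01 W0(1) pow] m by simp
    then have "map ((\<lambda>z. u * z) \<circ> f) P = regular_vertices n R"
      using uW len by (intro nth_equalityI)
        (simp_all add: regular_vertices_def W_def r_def unity_root_power)
    with rot that show thesis by blast
  next
    case False
    \<comment> \<open>For \<open>2 * m > n\<close> the vertices run clockwise; conjugation replaces
      \<open>m\<close> by \<open>n - m\<close>, which is at most half of \<open>n\<close>.\<close>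
    define W' where "W' = map cnj W"
    have W': "hyp_polygon n W'" unfolding W'_def by (rule hyp_polygon_isometry[OF hyp_isometry_cnj W])
    have cm: "cnj (unity_root n m) = unity_root n (n - m)"
      using m by (simp add: unity_root_cnj)
    have "n - m = 1"
    proof (rule star_polygon_simple[OF W' r01])
      show "cmod (W' ! 0) = r" using W0 n n0 by (simp add: W'_def)
      show "W' ! i = W' ! 0 * unity_root n (n - m) ^ i" if "i < n" for i
        using arg_cong[OF pow[OF that], of cnj] that n n0 by (simp add: W'_def cm)
    qed (use False m in auto)
    then have "cnj (unity_root n m) ^ i = unity_root n i" for i
      by (simp add: cm unity_root_power)
    then have "map (cnj \<circ> ((\<lambda>z. u * z) \<circ> f)) P = regular_vertices n R"
      using arg_cong[OF uW, of _ cnj] len by (intro nth_equalityI)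
        (simp_all add: regular_vertices_def W_def r_def)
    with hyp_isometry_comp[OF rot hyp_isometry_cnj] that show thesis by blast
  qed
qed

text \<open>Both polygons have the same normal form, so one isometry followed by the inverse of the
  other matches the vertex lists in order and hence the sides.\<close>

lemma regular_polygons_isometric:
  assumes P: "hyp_polygon n P" "circumcircle P c R"
      "\<And>i j. i < n \<Longrightarrow> j < n \<Longrightarrow> side_length P i = side_length P j"
    and Q: "hyp_polygon n Q" "circumcircle Q c' R"
      "\<And>i j. i < n \<Longrightarrow> j < n \<Longrightarrow> side_length Q i = side_length Q j"
  shows "isometric_polygons P Q"
proof -
  obtain f where f: "hyp_isometry f" "map f P = regular_vertices n R"
    using regular_polygon_normal_form[OF P] by blast
  obtain g where g: "hyp_isometry g" "map g Q = regular_vertices n R"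
    using regular_polygon_normal_form[OF Q] by blast
  let ?h = "inv_into hyp_plane g \<circ> f"
  have h: "hyp_isometry ?h" by (intro hyp_isometry_comp hyp_isometry_inv f g)
  have "set P \<subseteq> hyp_plane" "set Q \<subseteq> hyp_plane" using P Q by (auto simp: hyp_polygon_def)
  have "map ?h P = map (inv_into hyp_plane g \<circ> g) Q"
    using f g by (simp flip: map_map)
  also have "\<dots> = Q"
    using \<open>set Q \<subseteq> hyp_plane\<close> g by (intro map_idI) (auto simp: hyp_isometry_def bij_betw_def)
  finally have "map ?h P = Q" .
  then have "(\<lambda>s. ?h ` s) ` hyp_sides P = hyp_sides Q"
    using hyp_sides_isometry[OF h \<open>set P \<subseteq> hyp_plane\<close>] by simp
  with h show ?thesis unfolding isometric_polygons_def by blast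
qed

text \<open>Half a side \<open>s\<close> is the leg opposite the angle pi / n in a right triangle
  with hypotenuse \<open>R\<close>, whence sinh (s / 2) = sin (pi / n) sinh R. The computation
  reaches this through cosh s = 1 + 2 (sinh (s / 2))^2.\<close>

lemma hyp_dist_regular_vertices:
  assumes "n \<ge> 3" and "R > 0"
  shows "hyp_dist (of_real (tanh (R / 2))) (of_real (tanh (R / 2)) * unity_root n 1)
       = 2 * arsinh (sin (pi / n) * sinh R)"
proof -
  define r where "r = tanh (R / 2)"
  have "sin (pi / n) > 0" using assms by (intro sin_gt_zero) (auto simp: field_simps)
  have "of_real r - of_real r * unity_root n 1 = of_real r * (1 - cis (2 * pi / n))"
    by (simp add: unity_root_def right_diff_distrib)
  moreover have "(cmod (1 - cis (2 * x)))\<^sup>2 = (2 * sin x)\<^sup>2" for x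
  proof -
    have "(cmod (1 - cis (2 * x)))\<^sup>2 = 2 - 2 * cos (2 * x)"
      using sin_cos_squared_add[of "2 * x"] unfolding cmod_power2
      by (simp add: power2_eq_square algebra_simps)
    then show ?thesis by (simp add: cos_double_sin power_mult_distrib)
  qed
  from this[of "pi / n"] have "(cmod (1 - cis (2 * pi / n)))\<^sup>2 = (2 * sin (pi / n))\<^sup>2"
    by simp
  ultimately have num: "(cmod (of_real r - of_real r * unity_root n 1))\<^sup>2 = r\<^sup>2 * (2 * sin (pi / n))\<^sup>2"
    by (simp add: norm_mult power_mult_distrib)
  have "hyp_dist (of_real r) (of_real r * unity_root n 1)
      = arcosh (1 + 2 * (sin (pi / n) * (2 * r / (1 - r\<^sup>2)))\<^sup>2)"
    unfolding hyp_dist_def num by (simp add: norm_mult power2_eq_square mult_ac)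
  also have "2 * r / (1 - r\<^sup>2) = sinh R" by (simp add: r_def cosh_sinh_half_tanh(2))
  also have "1 + 2 * (sin (pi / n) * sinh R)\<^sup>2 = cosh (2 * arsinh (sin (pi / n) * sinh R))"
    by (simp add: cosh_double cosh_square_eq)
  also have "arcosh \<dots> = 2 * arsinh (sin (pi / n) * sinh R)"
    using assms \<open>sin (pi / n) > 0\<close> by (intro arcosh_cosh_real) (simp add: less_imp_le)
  finally show ?thesis by (simp add: r_def)
qed

lemma perimeter_regular:
  assumes P: "hyp_polygon n P" and c: "circumcircle P c R"
    and eq: "\<And>i j. i < n \<Longrightarrow> j < n \<Longrightarrow> side_length P i = side_length P j"
  shows "perimeter P = 2 * real n * arsinh (sin (pi / n) * sinh R)"
proof -
  obtain f where f: "hyp_isometry f" "map f P = regular_vertices n R"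
    using regular_polygon_normal_form[OF assms] by blast
  have n: "n \<ge> 3" "length P = n" "set P \<subseteq> hyp_plane" and "R > 0"
    using P c by (auto simp: hyp_polygon_def circumcircle_def)
  have "side_length P 0 = side_length (regular_vertices n R) 0"
    using hyp_side_isometry(3)[of f P 0] f n by auto
  also have "\<dots> = 2 * arsinh (sin (pi / n) * sinh R)"
    using hyp_dist_regular_vertices[OF n(1) \<open>R > 0\<close>] n
    by (simp add: side_length_def next_vertex_def regular_vertices_def)
  finally have "side_length P i = 2 * arsinh (sin (pi / n) * sinh R)" if "i < n" for i
    using eq[of i 0] that by simp
  then show ?thesis by (simp add: perimeter_def n(2))
qed

section \<open>The inequality and its equality case\<close>

theorem theorem1p6:
  fixes n k :: nat and P :: "nat \<Rightarrow> complex list" and T :: real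
  assumes "n \<ge> 3" and "k \<ge> 1"
    and "\<And>i. i \<in> {1..k} \<Longrightarrow> hyp_polygon n (P i)"
    and "\<And>i. i \<in> {1..k} \<Longrightarrow> cyclic_polygon (P i)"
    and "\<And>i. i \<in> {1..k} \<Longrightarrow> centered_polygon (P i)"
    and "\<And>i. i \<in> {1..k} \<Longrightarrow> regular_polygon (P i)"
    and "(\<Sum>i=1..k. circumradius (P i)) = T"
  shows "(\<Sum>i=1..k. perimeter (P i))
           \<ge> 2 * real n * real k * arsinh (sin (pi / real n) * sinh (T / real k)) \<and>
         ((\<Sum>i=1..k. perimeter (P i))
           = 2 * real n * real k * arsinh (sin (pi / real n) * sinh (T / real k)) \<longleftrightarrow>
          (\<exists>Q. hyp_polygon n Q \<and> cyclic_polygon Q \<and> regular_polygon Q \<and>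
               circumradius Q = T / real k \<and>
               (\<forall>i\<in>{1..k}. isometric_polygons (P i) Q)))"
proof -
  define a where "a = sin (pi / real n)"
  define R where "R i = circumradius (P i)" for i
  define S where "S = (\<Sum>i=1..k. arsinh (a * sinh (R i)))"
  define M where "M = arsinh (a * sinh (T / real k))"
  note poly = assms(3)
  \<comment> \<open>The value of \<open>circumradius\<close> is attained by an actual circumcircle,
    so the results on inscribed polygons apply with radius \<open>R i\<close>.\<close>
  have circ: "\<exists>c. circumcircle (P i) c (R i)" if i: "i \<in> {1..k}" for i
  proof -
    obtain c r where c: "circumcircle (P i) c r"
      using assms(4)[OF i] by (auto simp: cyclic_polygon_def)
    moreover have "R i = r" unfolding R_def by (rule circumradius_eq[OF poly[OF i] c])
    ultimately show ?thesis by blast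
  qed
  have sides: "side_length (P i) j = side_length (P i) l" if "i \<in> {1..k}" "j < n" "l < n" for i j l
    using assms(6)[OF that(1)] poly[OF that(1)] that(2,3)
    unfolding regular_polygon_def hyp_polygon_def by blast
  have peri: "perimeter (P i) = 2 * real n * arsinh (a * sinh (R i))" if i: "i \<in> {1..k}" for i
  proof -
    obtain c where "circumcircle (P i) c (R i)" using circ[OF i] by blast
    from perimeter_regular[OF poly[OF i] this sides[OF i]] show ?thesis by (simp add: a_def)
  qed
  then have sum_peri: "(\<Sum>i=1..k. perimeter (P i)) = 2 * real n * S"
    by (simp add: S_def sum_distrib_left)
  \<comment> \<open>\<open>n \<ge> 3\<close> puts \<open>pi / n\<close> strictly below
    \<open>pi / 2\<close>; the resulting \<open>a < 1\<close> is what strict convexity uses.\<close>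
  have a: "0 < a" "a < 1"
  proof -
    have "0 < pi / n" "pi / n < pi / 2"
      using assms(1) divide_strict_left_mono[of 2 "real n" pi] by simp_all
    moreover from this(2) have "pi / n < pi" using pi_gt_zero by linarith
    ultimately show "0 < a" "a < 1"
      using sin_gt_zero[of "pi / n"] sin_monotone_2pi[of "pi / n" "pi / 2"] by (auto simp: a_def)
  qed
  have R_pos: "0 < R i" if "i \<in> {1..k}" for i
    using circ[OF that] by (auto simp: circumcircle_def)
  have mean: "(\<Sum>i=1..k. R i) / real (card {1..k}) = T / real k"
    using assms(7) by (simp add: R_def)
  have ne: "{1..k} \<noteq> {}" using assms(2) by simp
  note jensen = sum_arsinh_sinh_ge[where R = R, OF a finite_atLeastAtMost ne R_pos, unfolded mean]
  have ge: "real k * M \<le> S" and eq: "S = real k * M \<longleftrightarrow> (\<forall>i\<in>{1..k}. R i = T / real k)"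
    using jensen by (simp_all add: S_def M_def)
  \<comment> \<open>Equality in Jensen's inequality means that all circumradii agree; it remains to
    translate this into congruence to one regular polygon.\<close>
  have "(\<forall>i\<in>{1..k}. R i = T / real k) \<longleftrightarrow>
      (\<exists>Q. hyp_polygon n Q \<and> cyclic_polygon Q \<and> regular_polygon Q \<and>
        circumradius Q = T / real k \<and> (\<forall>i\<in>{1..k}. isometric_polygons (P i) Q))"
  proof
    assume R: "\<forall>i\<in>{1..k}. R i = T / real k"
    \<comment> \<open>\<open>P 1\<close> will serve as the common model \<open>Q\<close>; it exists
      because \<open>k \<ge> 1\<close>.\<close>
    have 1: "1 \<in> {1..k}" using assms(2) by simp
    have "isometric_polygons (P i) (P 1)" if i: "i \<in> {1..k}" for i
    proof -
      obtain c c' where "circumcircle (P i) c (T / real k)" "circumcircle (P 1) c' (T / real k)"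
        using circ[OF i] circ[OF 1] R i 1 by auto
      from regular_polygons_isometric[OF poly[OF i] this(1) sides[OF i] poly[OF 1] this(2) sides[OF 1]]
      show ?thesis .
    qed
    then show "\<exists>Q. hyp_polygon n Q \<and> cyclic_polygon Q \<and> regular_polygon Q \<and>
        circumradius Q = T / real k \<and> (\<forall>i\<in>{1..k}. isometric_polygons (P i) Q)"
      using assms(4,6)[OF 1] poly[OF 1] R 1 by (intro exI[of _ "P 1"]) (auto simp: R_def)
  next
    assume "\<exists>Q. hyp_polygon n Q \<and> cyclic_polygon Q \<and> regular_polygon Q \<and>
        circumradius Q = T / real k \<and> (\<forall>i\<in>{1..k}. isometric_polygons (P i) Q)"
    then show "\<forall>i\<in>{1..k}. R i = T / real k"
      using isometric_polygons_circumradius_eq poly assms(4) unfolding R_def by metis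
  qed
  with ge eq show ?thesis
    unfolding sum_peri a_def[symmetric] M_def[symmetric] using assms(1) by simp
qed

end
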